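(* Let $p$ be a nonconstant real polynomial and let $Q=(p'/p)'=\dfrac{pp''-(p')^2}{p^2}$. Suppose that $p$ has $2m$ nonreal zeroes and its derivative $p'$ has $2m_1$ nonreal zeroes (counting multiplicities). Then $Q$ has at least $2m-2m_1$ real zeroes, counting multiplicities.
   Context: A real polynomial is a polynomial with real coefficients. Zeroes of the rational function $Q$ are counted with multiplicities. *)

theory Defs
  imports Complex_Main "HOL-Computational_Algebra.Computational_Algebra"
    "HOL-Computational_Algebra.Field_as_Ring"
begin

definition nonreal_zeroes :: "real poly \<Rightarrow> complex multiset" where
  "nonreal_zeroes p = {#z \<in># proots (map_poly complex_of_real p). z \<notin> \<real>#}"

(* Real rational functions are elements of the fraction field of the real polynomials. The
   derivative is given by the quotient rule on the reduced representation; the following lemma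
   shows that any representation may be used. *)
definition rat_deriv :: "real poly fract \<Rightarrow> real poly fract" where
  "rat_deriv f = (case quot_of_fract f of (a, b) \<Rightarrow> Fract (pderiv a * b - a * pderiv b) (b ^ 2))"

lemma rat_deriv_Fract:
  fixes a b :: "real poly"
  assumes b: "b \<noteq> 0"
  shows "rat_deriv (Fract a b) = Fract (pderiv a * b - a * pderiv b) (b ^ 2)"
proof -
  obtain c d where cd: "quot_of_fract (Fract a b) = (c, d)"
    by fastforce
  have d: "d \<noteq> 0"
    using snd_quot_of_fract_nonzero[of "Fract a b"] cd by simp
  have "Fract c d = Fract a b"
    using Fract_quot_of_fract[of "Fract a b"] cd by simp
  then have eq: "c * b = a * d"
    using b d by (simp add: eq_fract)
  then have "pderiv (c * b) = pderiv (a * d)"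
    by simp
  then have deq: "pderiv c * b + c * pderiv b = pderiv a * d + a * pderiv d"
    by (simp add: pderiv_mult algebra_simps)
  have "(pderiv c * d - c * pderiv d) * b ^ 2 = (pderiv a * b - a * pderiv b) * d ^ 2"
    using eq deq by algebra
  then show ?thesis
    using b d by (simp add: rat_deriv_def cd eq_fract)
qed

lemma rat_deriv_logderiv:
  fixes p :: "real poly"
  assumes "p \<noteq> 0"
  shows "rat_deriv (Fract (pderiv p) p)
           = Fract (p * pderiv (pderiv p) - (pderiv p) ^ 2) (p ^ 2)"
  using rat_deriv_Fract[OF assms, of "pderiv p"] by (simp add: power2_eq_square mult.commute)

(* The zeroes of a rational function are those of its numerator in lowest terms. *)
definition real_zeroes_rat :: "real poly fract \<Rightarrow> real multiset" where
  "real_zeroes_rat f = proots (fst (quot_of_fract f))"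

lemma count_real_zeroes_rat:
  fixes a b :: "real poly"
  assumes a: "a \<noteq> 0" and b: "b \<noteq> 0"
  shows "count (real_zeroes_rat (Fract a b)) x = order x a - order x b"
proof -
  obtain c d where cd: "quot_of_fract (Fract a b) = (c, d)"
    by fastforce
  have d: "d \<noteq> 0"
    using snd_quot_of_fract_nonzero[of "Fract a b"] cd by simp
  have "Fract c d = Fract a b"
    using Fract_quot_of_fract[of "Fract a b"] cd by simp
  then have eq: "c * b = a * d"
    using b d by (simp add: eq_fract)
  then have c: "c \<noteq> 0"
    using a d by auto
  have "order x (c * b) = order x (a * d)"
    using eq by simp
  then have ord: "order x c + order x b = order x a + order x d"
    using a b c d by (simp add: order_mult)
  have "coprime c d"
    using coprime_quot_of_fract[of "Fract a b"] cd by simp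
  moreover have "\<not> [:- x, 1:] dvd 1"
    by (simp add: is_unit_iff_degree)
  ultimately have "\<not> (poly c x = 0 \<and> poly d x = 0)"
    using not_coprimeI[of "[:- x, 1:]" c d] by (auto simp: poly_eq_0_iff_dvd)
  then have "order x c = 0 \<or> order x d = 0"
    by (auto simp: order_root)
  then show ?thesis
    using ord c by (auto simp: real_zeroes_rat_def cd)
qed

end

theory Submission
  imports Defs "HOL-Library.Extended_Real"
begin

text \<open>
  The zeroes of \<open>Q\<close> are the critical points of the logarithmic derivative \<open>R = p'/p\<close>, and they are
  found with Rolle's theorem. Let \<open>P\<close> be the set of the real zeroes of \<open>p\<close>, which are the real poles of
  \<open>R\<close>, and let \<open>Z\<close> be the set of the real zeroes of \<open>R\<close>. Since \<open>R\<close> also vanishes at infinity, the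
  points \<open>-\<infinity>\<close> and \<open>\<infinity>\<close> behave like zeroes of \<open>R\<close>. There are two sources of real zeroes of \<open>Q\<close>.

  First, the finite set \<open>P \<union> Z\<close> and the two infinite points cut the line into \<open>|Z| + |P| + 1\<close> gaps.
  In a gap without an end point in \<open>P\<close>, the function \<open>R\<close> is differentiable and tends to zero at both
  ends, so that it has a critical point (\<open>rolle_vanishing_ends\<close>). Each pole is an end point of only two
  gaps, so at least \<open>|Z| - |P| + 1\<close> gaps provide a zero of \<open>Q\<close> outside \<open>P \<union> Z\<close>
  (\<open>card_gaps\<close>, \<open>critical_points_off_zeroes\<close>).

  Second, a zero of \<open>R\<close> of multiplicity \<open>k\<close> is a zero of \<open>Q\<close> of multiplicity at least \<open>k - 1\<close>
  (\<open>order_logderiv_numerator\<close>). With \<open>N\<close> the number of zeroes of \<open>R\<close> counted with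
  multiplicities, these are at least \<open>N - |Z|\<close> further zeroes.

  Together \<open>Q\<close> has at least \<open>N - |P| + 1\<close> real zeroes. Finally, \<open>N\<close> is known: \<open>p\<close> has \<open>n - 2m\<close> real
  zeroes and \<open>p'\<close> has \<open>n - 1 - 2m\<^sub>1\<close>, where \<open>n\<close> is the degree of \<open>p\<close>, and differentiation lowers the
  multiplicity of each point of \<open>P\<close> by one. Hence
  \<open>N = (n - 1 - 2m\<^sub>1) - (n - 2m - |P|) = 2m - 2m\<^sub>1 + |P| - 1\<close>, and the two counts give the bound.
\<close>

section \<open>Real and nonreal zeroes of a real polynomial\<close>

lemma poly_map_of_real:
  "poly (map_poly complex_of_real p) (complex_of_real x) = complex_of_real (poly p x)"
  by (induction p) (auto simp: map_poly_pCons)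

lemma pderiv_map_of_real:
  "pderiv (map_poly complex_of_real p) = map_poly complex_of_real (pderiv p)"
  by (rule poly_eqI) (simp add: coeff_pderiv coeff_map_poly)

lemma map_of_real_eq_0_iff: "map_poly complex_of_real p = 0 \<longleftrightarrow> p = 0"
  by (auto simp: poly_eq_iff coeff_map_poly)

text \<open>
  In characteristic zero the multiplicity of a zero is the number of times that one can differentiate
  before the value at the point becomes nonzero, and this does not depend on the field.
\<close>

lemma order_map_of_real:
  assumes "p \<noteq> 0"
  shows "order (complex_of_real x) (map_poly complex_of_real p) = order x p"
  using assms
proof (induction "order x p" arbitrary: p)
  case 0
  then have "poly p x \<noteq> 0"
    by (simp add: order_root)
  then have "poly (map_poly complex_of_real p) (complex_of_real x) \<noteq> 0"
    by (simp add: poly_map_of_real)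
  then show ?case
    using 0 by (simp add: order_0I)
next
  case (Suc k)
  have root: "poly p x = 0"
    using Suc.hyps(2) by (simp add: order_root)
  have ord: "order x p = Suc (order x (pderiv p))"
    by (rule order_pderiv) (use Suc.prems root in auto)
  have nz: "pderiv p \<noteq> 0"
    using pderiv_iszero[of p] Suc.prems root by auto
  have "order (complex_of_real x) (map_poly complex_of_real p)
      = Suc (order (complex_of_real x) (pderiv (map_poly complex_of_real p)))"
    by (rule order_pderiv) (use Suc.prems root in \<open>auto simp: map_of_real_eq_0_iff poly_map_of_real\<close>)
  also have "\<dots> = Suc (order x (pderiv p))"
    using Suc.hyps(1)[of "pderiv p"] Suc.hyps(2) ord nz by (simp add: pderiv_map_of_real)
  finally show ?case
    using ord by simp
qed

lemma real_part_of_proots_map_of_real: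
  assumes "p \<noteq> 0"
  shows "{#z \<in># proots (map_poly complex_of_real p). z \<in> \<real>#} = image_mset complex_of_real (proots p)"
proof (rule multiset_eqI)
  fix z :: complex
  show "count {#z \<in># proots (map_poly complex_of_real p). z \<in> \<real>#} z
      = count (image_mset complex_of_real (proots p)) z"
  proof (cases "z \<in> \<real>")
    case True
    then obtain x where z: "z = complex_of_real x"
      by (auto elim: Reals_cases)
    have "count (image_mset complex_of_real M) z = count M x" for M
      unfolding z by (induction M) auto
    then show ?thesis
      using assms True z by (simp add: order_map_of_real map_of_real_eq_0_iff)
  next
    case False
    then have "z \<notin># image_mset complex_of_real (proots p)"
      by auto
    then have "count (image_mset complex_of_real (proots p)) z = 0"
      by (simp only: not_in_iff)
    then show ?thesis
      using False by simp
  qed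
qed

lemma degree_eq_real_plus_nonreal_zeroes:
  assumes "p \<noteq> 0"
  shows "degree p = size (proots p) + size (nonreal_zeroes p)"
proof -
  have "degree p = degree (map_poly complex_of_real p)"
    by (simp add: degree_map_poly)
  also have "\<dots> = size (proots (map_poly complex_of_real p))"
    by (simp add: size_proots_complex)
  also have "\<dots> = size {#z \<in># proots (map_poly complex_of_real p). z \<in> \<real>#} + size (nonreal_zeroes p)"
    unfolding nonreal_zeroes_def
    by (metis multiset_partition size_union)
  finally show ?thesis
    using assms by (simp add: real_part_of_proots_map_of_real)
qed

lemma size_proots_eq_sum_order:
  fixes p :: "real poly"
  assumes "p \<noteq> 0" "finite A" "{x. poly p x = 0} \<subseteq> A"
  shows "size (proots p) = (\<Sum>x\<in>A. order x p)"
proof -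
  have "size (proots p) = (\<Sum>x | poly p x = 0. order x p)"
    using assms by (simp add: size_multiset_overloaded_eq)
  also have "\<dots> = (\<Sum>x\<in>A. order x p)"
    by (rule sum.mono_neutral_left) (use assms in \<open>auto simp: order_0I\<close>)
  finally show ?thesis .
qed

lemma sum_count_le_size:
  assumes "finite A"
  shows "(\<Sum>x\<in>A. count M x) \<le> size M"
proof -
  have "(\<Sum>x\<in>A. count M x) = (\<Sum>x\<in>A \<inter> set_mset M. count M x)"
    by (rule sum.mono_neutral_right) (use assms in \<open>auto simp: not_in_iff\<close>)
  also have "\<dots> \<le> size M"
    unfolding size_multiset_overloaded_eq by (rule sum_mono2) auto
  finally show ?thesis .
qed

section \<open>Rolle's theorem and gaps between marked points\<close>

text \<open>
  Coming arbitrarily close to zero towards both ends of the interval is all that remains of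
  equal boundary values in Rolle's theorem when the ends may be infinite. If the function
  is positive somewhere, then its maximum over a large compact subinterval is not at an end.
\<close>

lemma rolle_vanishing_ends_pos:
  fixes f f' :: "real \<Rightarrow> real" and a b :: ereal
  assumes deriv: "\<And>x. a < ereal x \<Longrightarrow> ereal x < b \<Longrightarrow> (f has_real_derivative f' x) (at x)"
    and left: "\<And>c e. a < ereal c \<Longrightarrow> e > 0 \<Longrightarrow> \<exists>u<c. a < ereal u \<and> \<bar>f u\<bar> < e"
    and right: "\<And>c e. ereal c < b \<Longrightarrow> e > 0 \<Longrightarrow> \<exists>v>c. ereal v < b \<and> \<bar>f v\<bar> < e"
    and c: "a < ereal c" "ereal c < b" "f c > 0"
  shows "\<exists>x. a < ereal x \<and> ereal x < b \<and> f' x = 0"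
proof -
  obtain u where u: "u < c" "a < ereal u" "f u < f c"
    using left[OF c(1) c(3)] by fastforce
  obtain v where v: "v > c" "ereal v < b" "f v < f c"
    using right[OF c(2) c(3)] by fastforce
  have inside: "a < ereal x \<and> ereal x < b" if "x \<in> {u..v}" for x
    using that u(2) v(2) by (metis atLeastAtMost_iff ereal_less_eq(3) less_le_trans le_less_trans)
  have "continuous_on {u..v} f"
    by (rule continuous_at_imp_continuous_on) (use inside deriv in \<open>blast intro: DERIV_isCont\<close>)
  then obtain x where x: "x \<in> {u..v}" "\<And>y. y \<in> {u..v} \<Longrightarrow> f y \<le> f x"
    using continuous_attains_sup[of "{u..v}" f] u v by fastforce
  have "f c \<le> f x"
    using x(2)[of c] u v by simp
  then have "x \<noteq> u" "x \<noteq> v"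
    using u v by auto
  then have uxv: "u < x" "x < v"
    using x(1) by auto
  have "f' x = 0"
  proof (rule DERIV_local_max)
    show "(f has_real_derivative f' x) (at x)"
      using deriv inside x(1) by blast
    show "0 < min (x - u) (v - x)"
      using uxv by simp
    show "\<forall>y. \<bar>x - y\<bar> < min (x - u) (v - x) \<longrightarrow> f y \<le> f x"
      using x(2) by (auto simp: abs_if split: if_splits)
  qed
  then show ?thesis
    using inside x(1) by blast
qed

lemma rolle_vanishing_ends:
  fixes f f' :: "real \<Rightarrow> real" and a b :: ereal
  assumes "a < b"
    and deriv: "\<And>x. a < ereal x \<Longrightarrow> ereal x < b \<Longrightarrow> (f has_real_derivative f' x) (at x)"
    and left: "\<And>c e. a < ereal c \<Longrightarrow> e > 0 \<Longrightarrow> \<exists>u<c. a < ereal u \<and> \<bar>f u\<bar> < e"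
    and right: "\<And>c e. ereal c < b \<Longrightarrow> e > 0 \<Longrightarrow> \<exists>v>c. ereal v < b \<and> \<bar>f v\<bar> < e"
  shows "\<exists>x. a < ereal x \<and> ereal x < b \<and> f' x = 0"
proof (cases "\<exists>c. a < ereal c \<and> ereal c < b \<and> f c \<noteq> 0")
  case True
  then obtain c where c: "a < ereal c" "ereal c < b" "f c \<noteq> 0"
    by blast
  define s where "s = sgn (f c)"
  have s: "\<bar>s\<bar> = 1" "s * f c > 0"
    using c(3) by (auto simp: s_def sgn_if)
  have "\<exists>x. a < ereal x \<and> ereal x < b \<and> s * f' x = 0"
  proof (rule rolle_vanishing_ends_pos[where f = "\<lambda>x. s * f x", OF _ _ _ c(1,2) s(2)])
    show "((\<lambda>x. s * f x) has_real_derivative s * f' x) (at x)" if "a < ereal x" "ereal x < b" for x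
      using deriv[OF that] by (rule DERIV_cmult)
  qed (use left right s(1) in \<open>auto simp: abs_mult\<close>)
  then show ?thesis
    using s(1) by auto
next
  case False
  obtain c where c: "a < ereal c" "ereal c < b"
    using ereal_dense2[OF \<open>a < b\<close>] by blast
  have "open (ereal -` {a<..<b})"
    by (rule open_ereal_vimage) simp
  then have "(f has_real_derivative 0) (at c)"
    by (rule has_field_derivative_transform_within_open[OF DERIV_const]) (use c False in auto)
  then have "f' c = 0"
    using deriv[OF c] by (rule DERIV_unique[symmetric])
  then show ?thesis
    using c by blast
qed

text \<open>
  Call a point of \<open>S\<close> good if it is not the last one and neither it nor its successor lies in \<open>P\<close>. Each
  point of \<open>P\<close> spoils at most itself and its predecessor. Gaps that start at different
  good points are disjoint, so their members of \<open>W\<close> are distinct.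
\<close>

lemma card_gaps:
  fixes S P W :: "'a::linorder set"
  assumes fin: "finite S" "finite W" and "P \<subseteq> S"
    and gap: "\<And>a b. a \<in> S - P \<Longrightarrow> b \<in> S - P \<Longrightarrow> a < b \<Longrightarrow> S \<inter> {a<..<b} = {} \<Longrightarrow> W \<inter> {a<..<b} \<noteq> {}"
  shows "card S \<le> card W + 2 * card P + 1"
proof (cases "S = {}")
  case False
  define S' where "S' = S - {Max S}"
  define next_pt where "next_pt a = Min {b \<in> S. a < b}" for a
  have next_pt: "next_pt a \<in> S" "a < next_pt a" "\<And>b. b \<in> S \<Longrightarrow> a < b \<Longrightarrow> next_pt a \<le> b"
    if "a \<in> S'" for a
  proof -
    have "a < Max S"
      using that fin(1) by (auto simp: S'_def intro: le_neq_trans)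
    then have "Max S \<in> {b \<in> S. a < b}"
      using fin(1) False by simp
    then have "next_pt a \<in> {b \<in> S. a < b}"
      unfolding next_pt_def by (intro Min_in) (use fin(1) in auto)
    then show "next_pt a \<in> S" "a < next_pt a"
      by auto
    show "next_pt a \<le> b" if "b \<in> S" "a < b" for b
      unfolding next_pt_def by (rule Min_le) (use fin(1) that in auto)
  qed
  define B where "B = {a \<in> S'. next_pt a \<in> P}"
  define G where "G = S' - P - B"
  have finP: "finite P"
    using fin(1) \<open>P \<subseteq> S\<close> by (rule rev_finite_subset)
  have finS': "finite S'"
    using fin(1) by (simp add: S'_def)
  have "inj_on next_pt S'"
  proof (rule linorder_inj_onI)
    fix a a' assume "a < a'" "a \<in> S'" "a' \<in> S'"
    then have "next_pt a \<le> a'" "a' < next_pt a'"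
      using next_pt by (auto simp: S'_def)
    then show "next_pt a \<noteq> next_pt a'"
      by auto
  qed auto
  then have "card B \<le> card P"
    by (intro card_inj_on_le[of next_pt]) (use finP in \<open>auto simp: B_def inj_on_def\<close>)
  have "card S = Suc (card S')"
    unfolding S'_def by (rule card_Suc_Diff1[symmetric]) (use fin(1) False in auto)
  also have "card S' \<le> card (G \<union> (P \<union> B))"
    by (rule card_mono) (use finP finS' in \<open>auto simp: G_def B_def\<close>)
  also have "\<dots> \<le> card G + (card P + card B)"
    by (meson add_left_mono card_Un_le order_trans)
  finally have card_S: "card S \<le> card G + 2 * card P + 1"
    using \<open>card B \<le> card P\<close> by simp
  have "\<exists>w\<in>W. a < w \<and> w < next_pt a" if "a \<in> G" for a
  proof -
    have a: "a \<in> S'" "a \<notin> P" "next_pt a \<notin> P"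
      using that by (auto simp: G_def B_def)
    have "S \<inter> {a<..<next_pt a} = {}"
      using next_pt(3)[OF a(1)] by force
    then have "W \<inter> {a<..<next_pt a} \<noteq> {}"
      by (intro gap) (use a next_pt in \<open>auto simp: S'_def\<close>)
    then show ?thesis
      by auto
  qed
  then obtain w where w: "\<And>a. a \<in> G \<Longrightarrow> w a \<in> W \<and> a < w a \<and> w a < next_pt a"
    by metis
  have "inj_on w G"
  proof (rule linorder_inj_onI)
    fix a a' assume a: "a < a'" "a \<in> G" "a' \<in> G"
    then have "next_pt a \<le> a'"
      using next_pt(3)[of a a'] by (auto simp: G_def S'_def)
    then have "w a < w a'"
      using w[OF a(2)] w[OF a(3)] by (meson less_trans less_le_trans)
    then show "w a \<noteq> w a'"
      by simp
  qed auto
  then have "card G \<le> card W"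
    by (rule card_inj_on_le) (use w fin(2) in auto)
  then show ?thesis
    using card_S by simp
qed simp

section \<open>Critical points of the logarithmic derivative\<close>

lemma logderiv_has_derivative:
  fixes p :: "real poly"
  assumes "poly p x \<noteq> 0"
  shows "((\<lambda>x. poly (pderiv p) x / poly p x) has_real_derivative
      poly (p * pderiv (pderiv p) - (pderiv p) ^ 2) x / (poly p x) ^ 2) (at x)"
  by (rule derivative_eq_intros poly_DERIV refl)+
    (use assms in \<open>auto simp: power2_eq_square field_simps\<close>)

text \<open>
  If the numerator vanished, the leading coefficients of \<open>p * p''\<close> and \<open>p'\<^sup>2\<close> would agree,
  that is, \<open>n (n - 1) = n\<^sup>2\<close> for the degree \<open>n\<close>.
\<close>

lemma logderiv_numerator_nonzero:
  fixes p :: "real poly"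
  assumes "degree p > 0"
  shows "p * pderiv (pderiv p) - (pderiv p) ^ 2 \<noteq> 0"
proof
  assume "p * pderiv (pderiv p) - (pderiv p) ^ 2 = 0"
  then have eq: "p * pderiv (pderiv p) = pderiv p * pderiv p"
    by (simp add: power2_eq_square)
  let ?n = "real (degree p)" and ?l = "lead_coeff p"
  have lead: "lead_coeff (pderiv q) = real (degree q) * lead_coeff q" for q :: "real poly"
    by (cases "degree q") (auto simp: coeff_pderiv degree_pderiv coeff_eq_0)
  have "?l * ((?n - 1) * (?n * ?l)) = (?n * ?l) * (?n * ?l)"
  proof -
    have "real (degree (pderiv p)) = ?n - 1"
      using assms by (simp add: degree_pderiv of_nat_diff)
    then have lead2: "lead_coeff (pderiv (pderiv p)) = (?n - 1) * (?n * ?l)"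
      by (simp only: lead)
    have "?l * lead_coeff (pderiv (pderiv p)) = lead_coeff (pderiv p) * lead_coeff (pderiv p)"
      by (metis eq lead_coeff_mult)
    then show ?thesis
      by (simp only: lead2 lead[of p])
  qed
  then have "?n * ?l ^ 2 = 0"
    by (simp add: algebra_simps power2_eq_square)
  then show False
    using assms by auto
qed

text \<open>
  If \<open>x\<close> is a zero of \<open>p'\<close> of multiplicity \<open>k\<close>, then the power \<open>k - 1\<close> of the linear factor at \<open>x\<close>
  divides both \<open>p'\<close> and \<open>p''\<close>, hence the numerator.
\<close>

lemma order_logderiv_numerator:
  fixes p :: "real poly"
  assumes "degree p > 0"
  shows "order x (pderiv p) \<le> Suc (order x (p * pderiv (pderiv p) - (pderiv p) ^ 2))"
proof (cases "poly (pderiv p) x = 0")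
  case True
  have nz: "pderiv p \<noteq> 0"
    using assms by (simp add: pderiv_eq_0_iff)
  let ?k = "order x (pderiv (pderiv p))"
  have ord: "order x (pderiv p) = Suc ?k"
    by (rule order_pderiv[OF nz True])
  have "[:- x, 1:] ^ ?k dvd pderiv p"
    using nz ord by (simp add: order_divides)
  moreover have "[:- x, 1:] ^ ?k dvd pderiv (pderiv p)"
    by (rule order_1)
  ultimately have "[:- x, 1:] ^ ?k dvd p * pderiv (pderiv p) - (pderiv p) ^ 2"
    by (simp add: power2_eq_square dvd_diff)
  then show ?thesis
    using logderiv_numerator_nonzero[OF assms] ord by (simp add: order_divides)
qed (simp add: order_0I)

text \<open>
  An end point \<open>a\<close> is infinite or a point at which \<open>p' / p\<close> is continuous with value zero. At an
  infinite end point the quotient tends to zero because the degree of \<open>p'\<close> is less than that of \<open>p\<close>.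
\<close>

lemma logderiv_small_right_of:
  fixes p :: "real poly"
  assumes "degree p > 0" "a = - \<infinity> \<or> (\<exists>z. a = ereal z \<and> poly (pderiv p) z = 0 \<and> poly p z \<noteq> 0)"
    and "a < ereal c" "e > 0"
  shows "\<exists>u<c. a < ereal u \<and> \<bar>poly (pderiv p) u / poly p u\<bar> < e"
proof -
  let ?f = "\<lambda>x. poly (pderiv p) x / poly p x"
  from assms(2) show ?thesis
  proof (elim disjE exE conjE)
    assume a: "a = - \<infinity>"
    have "(?f \<longlongrightarrow> 0) at_infinity"
      using assms(1) by (intro poly_divide_tendsto_0_at_infinity) (simp add: degree_pderiv)
    then have "(?f \<longlongrightarrow> 0) at_bot"
      by (rule tendsto_mono[OF at_bot_le_at_infinity])
    from tendstoD[OF this \<open>e > 0\<close>]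
    have "\<forall>\<^sub>F u in at_bot. u < c \<and> dist (?f u) 0 < e"
      by (intro eventually_conj eventually_gt_at_bot)
    then obtain u where "u < c \<and> dist (?f u) 0 < e"
      by (auto dest!: eventually_happens)
    then show ?thesis
      using a by auto
  next
    fix z assume z: "a = ereal z" "poly (pderiv p) z = 0" "poly p z \<noteq> 0"
    have "isCont ?f z"
      using z(3) by (intro continuous_intros) auto
    then have "(?f \<longlongrightarrow> 0) (at z)"
      using z(2) by (simp add: isCont_def)
    then have "(?f \<longlongrightarrow> 0) (at_right z)"
      by (rule tendsto_mono[OF at_le, rotated]) simp
    from tendstoD[OF this \<open>e > 0\<close>]
    have "\<forall>\<^sub>F u in at_right z. u \<in> {z<..<c} \<and> dist (?f u) 0 < e"
      by (intro eventually_conj eventually_at_right_real) (use assms(3) z(1) in auto)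
    then obtain u where "u \<in> {z<..<c} \<and> dist (?f u) 0 < e"
      using eventually_happens'[OF trivial_limit_at_right_real] by blast
    then show ?thesis
      using z(1) by auto
  qed
qed

lemma logderiv_small_left_of:
  fixes p :: "real poly"
  assumes "degree p > 0" "b = \<infinity> \<or> (\<exists>z. b = ereal z \<and> poly (pderiv p) z = 0 \<and> poly p z \<noteq> 0)"
    and "ereal c < b" "e > 0"
  shows "\<exists>v>c. ereal v < b \<and> \<bar>poly (pderiv p) v / poly p v\<bar> < e"
proof -
  let ?f = "\<lambda>x. poly (pderiv p) x / poly p x"
  from assms(2) show ?thesis
  proof (elim disjE exE conjE)
    assume b: "b = \<infinity>"
    have "(?f \<longlongrightarrow> 0) at_infinity"
      using assms(1) by (intro poly_divide_tendsto_0_at_infinity) (simp add: degree_pderiv)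
    then have "(?f \<longlongrightarrow> 0) at_top"
      by (rule tendsto_mono[OF at_top_le_at_infinity])
    from tendstoD[OF this \<open>e > 0\<close>]
    have "\<forall>\<^sub>F v in at_top. v > c \<and> dist (?f v) 0 < e"
      by (intro eventually_conj eventually_gt_at_top)
    then obtain v where "v > c \<and> dist (?f v) 0 < e"
      by (auto dest!: eventually_happens)
    then show ?thesis
      using b by auto
  next
    fix z assume z: "b = ereal z" "poly (pderiv p) z = 0" "poly p z \<noteq> 0"
    have "isCont ?f z"
      using z(3) by (intro continuous_intros) auto
    then have "(?f \<longlongrightarrow> 0) (at z)"
      using z(2) by (simp add: isCont_def)
    then have "(?f \<longlongrightarrow> 0) (at_left z)"
      by (rule tendsto_mono[OF at_le, rotated]) simp
    from tendstoD[OF this \<open>e > 0\<close>]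
    have "\<forall>\<^sub>F v in at_left z. v \<in> {c<..<z} \<and> dist (?f v) 0 < e"
      by (intro eventually_conj eventually_at_left_real) (use assms(3) z(1) in auto)
    then obtain v where "v \<in> {c<..<z} \<and> dist (?f v) 0 < e"
      using eventually_happens'[OF trivial_limit_at_left_real] by blast
    then show ?thesis
      using z(1) by auto
  qed
qed

text \<open>
  The marked points are the \<open>|Z| + |P|\<close> real ones and the two infinite ones; only those in \<open>P\<close> are bad.
\<close>

lemma critical_points_off_zeroes:
  fixes p :: "real poly"
  assumes "degree p > 0"
  shows "card {x. poly (pderiv p) x = 0 \<and> poly p x \<noteq> 0} + 1
      \<le> card {x. poly p x = 0}
        + card {x. poly (p * pderiv (pderiv p) - (pderiv p) ^ 2) x = 0
                   \<and> poly p x \<noteq> 0 \<and> poly (pderiv p) x \<noteq> 0}"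
    (is "card ?Z + 1 \<le> card ?P + card ?W")
proof -
  let ?q = "p * pderiv (pderiv p) - (pderiv p) ^ 2"
  let ?S = "insert (- \<infinity>) (insert \<infinity> (ereal ` (?P \<union> ?Z)))"
  have nz: "p \<noteq> 0" "pderiv p \<noteq> 0" "?q \<noteq> 0"
    using assms logderiv_numerator_nonzero[OF assms] by (auto simp: pderiv_eq_0_iff)
  have finP: "finite ?P"
    using nz(1) by (rule poly_roots_finite)
  have finZ: "finite ?Z"
    by (rule finite_subset[OF _ poly_roots_finite[OF nz(2)]]) auto
  have finW: "finite ?W"
    by (rule finite_subset[OF _ poly_roots_finite[OF nz(3)]]) auto
  have "card ?S \<le> card (ereal ` ?W) + 2 * card (ereal ` ?P) + 1"
  proof (rule card_gaps)
    fix a b :: ereal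
    assume a: "a \<in> ?S - ereal ` ?P" and b: "b \<in> ?S - ereal ` ?P"
      and ab: "a < b" and empty: "?S \<inter> {a<..<b} = {}"
    have no_mark: "poly p x \<noteq> 0 \<and> poly (pderiv p) x \<noteq> 0" if "a < ereal x" "ereal x < b" for x
    proof -
      have "ereal x \<notin> ?S"
        using empty that by auto
      then show ?thesis
        by auto
    qed
    have a': "a = - \<infinity> \<or> (\<exists>z. a = ereal z \<and> poly (pderiv p) z = 0 \<and> poly p z \<noteq> 0)"
      using a ab by auto
    have b': "b = \<infinity> \<or> (\<exists>z. b = ereal z \<and> poly (pderiv p) z = 0 \<and> poly p z \<noteq> 0)"
      using b ab by auto
    have "\<exists>x. a < ereal x \<and> ereal x < b \<and> poly ?q x / (poly p x) ^ 2 = 0"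
    proof (rule rolle_vanishing_ends[OF ab])
      show "((\<lambda>x. poly (pderiv p) x / poly p x) has_real_derivative
          poly ?q x / (poly p x) ^ 2) (at x)" if "a < ereal x" "ereal x < b" for x
        by (rule logderiv_has_derivative) (use no_mark that in blast)
    qed (use logderiv_small_right_of[OF assms a'] logderiv_small_left_of[OF assms b'] in auto)
    then obtain x where x: "a < ereal x" "ereal x < b" "poly ?q x / (poly p x) ^ 2 = 0"
      by blast
    then have "x \<in> ?W"
      using no_mark[of x] by simp
    then show "ereal ` ?W \<inter> {a<..<b} \<noteq> {}"
      using x by auto
  qed (use finP finZ finW in auto)
  moreover have "card ?S = card (?P \<union> ?Z) + 2"
  proof -
    have "- \<infinity> \<notin> insert \<infinity> (ereal ` (?P \<union> ?Z))" "\<infinity> \<notin> ereal ` (?P \<union> ?Z)"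
      by auto
    then show ?thesis
      using finP finZ by (simp add: card_image)
  qed
  moreover have "card (?P \<union> ?Z) = card ?P + card ?Z"
    by (rule card_Un_disjoint) (use finP finZ in auto)
  ultimately show ?thesis
    by (simp add: card_image)
qed

theorem proposition1:
  fixes p :: "real poly" and Q :: "real poly fract" and m m1 :: nat
  assumes "degree p > 0"
    and "Q = rat_deriv (Fract (pderiv p) p)"
    and "size (nonreal_zeroes p) = 2 * m"
    and "size (nonreal_zeroes (pderiv p)) = 2 * m1"
  shows "int (size (real_zeroes_rat Q)) \<ge> 2 * int m - 2 * int m1"
proof -
  let ?q = "p * pderiv (pderiv p) - (pderiv p) ^ 2"
  let ?P = "{x. poly p x = 0}"
  let ?Z = "{x. poly (pderiv p) x = 0 \<and> poly p x \<noteq> 0}"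
  let ?W = "{x. poly ?q x = 0 \<and> poly p x \<noteq> 0 \<and> poly (pderiv p) x \<noteq> 0}"
  have nz: "p \<noteq> 0" "pderiv p \<noteq> 0" "?q \<noteq> 0"
    using assms(1) logderiv_numerator_nonzero[OF assms(1)] by (auto simp: pderiv_eq_0_iff)
  have finP: "finite ?P"
    using nz(1) by (rule poly_roots_finite)
  have finZ: "finite ?Z"
    by (rule finite_subset[OF _ poly_roots_finite[OF nz(2)]]) auto
  have finW: "finite ?W"
    by (rule finite_subset[OF _ poly_roots_finite[OF nz(3)]]) auto
  let ?N = "\<Sum>x\<in>?Z. order x (pderiv p)"

  have N: "?N + 2 * m1 + 1 = 2 * m + card ?P"
  proof -
    have "degree p = (\<Sum>x\<in>?P. order x p) + 2 * m"
      using degree_eq_real_plus_nonreal_zeroes[OF nz(1)]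
        size_proots_eq_sum_order[OF nz(1) finP] assms(3) by simp
    moreover have "(\<Sum>x\<in>?P. order x p) = (\<Sum>x\<in>?P. order x (pderiv p)) + card ?P"
    proof -
      have "(\<Sum>x\<in>?P. order x p) = (\<Sum>x\<in>?P. order x (pderiv p) + 1)"
        by (rule sum.cong) (use nz(1) order_pderiv in auto)
      then show ?thesis
        by (simp add: sum.distrib sum_Suc)
    qed
    moreover have "size (proots (pderiv p)) = (\<Sum>x\<in>?P. order x (pderiv p)) + ?N"
    proof -
      have "size (proots (pderiv p)) = (\<Sum>x\<in>?P \<union> ?Z. order x (pderiv p))"
        by (rule size_proots_eq_sum_order) (use nz(2) finP finZ in auto)
      also have "\<dots> = (\<Sum>x\<in>?P. order x (pderiv p)) + ?N"
        by (rule sum.union_disjoint) (use finP finZ in auto)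
      finally show ?thesis .
    qed
    moreover have "degree p = Suc (size (proots (pderiv p)) + 2 * m1)"
      using degree_eq_real_plus_nonreal_zeroes[OF nz(2)] assms(1,4) by (simp add: degree_pderiv)
    ultimately show ?thesis
      by simp
  qed

  have count_Q: "count (real_zeroes_rat Q) x = order x ?q" if "poly p x \<noteq> 0" for x
  proof -
    have "Q = Fract ?q (p ^ 2)"
      using rat_deriv_logderiv[OF nz(1)] assms(2) by simp
    moreover have "order x (p ^ 2) = 0"
      using that by (simp add: order_0I)
    ultimately show ?thesis
      using count_real_zeroes_rat[OF nz(3), of "p ^ 2" x] nz(1) by simp
  qed

  have "?N \<le> (\<Sum>x\<in>?Z. order x ?q + 1)"
    by (rule sum_mono) (use order_logderiv_numerator[OF assms(1)] in simp)
  also have "\<dots> = (\<Sum>x\<in>?Z. count (real_zeroes_rat Q) x) + card ?Z"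
    by (simp add: sum_Suc count_Q)
  finally have at_Z: "?N \<le> (\<Sum>x\<in>?Z. count (real_zeroes_rat Q) x) + card ?Z" .

  have "card ?W = (\<Sum>x\<in>?W. 1)"
    by simp
  also have "\<dots> \<le> (\<Sum>x\<in>?W. count (real_zeroes_rat Q) x)"
  proof (rule sum_mono)
    fix x assume "x \<in> ?W"
    then have "order x ?q \<noteq> 0"
      using nz(3) order_root[of ?q x] by blast
    then show "1 \<le> count (real_zeroes_rat Q) x"
      using count_Q \<open>x \<in> ?W\<close> by simp
  qed
  finally have at_W: "card ?W \<le> (\<Sum>x\<in>?W. count (real_zeroes_rat Q) x)" .

  have "(\<Sum>x\<in>?Z. count (real_zeroes_rat Q) x) + (\<Sum>x\<in>?W. count (real_zeroes_rat Q) x)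
      = (\<Sum>x\<in>?Z \<union> ?W. count (real_zeroes_rat Q) x)"
    by (rule sum.union_disjoint[symmetric]) (use finZ finW in auto)
  also have "\<dots> \<le> size (real_zeroes_rat Q)"
    by (rule sum_count_le_size) (use finZ finW in auto)
  finally show ?thesis
    using N at_Z at_W critical_points_off_zeroes[OF assms(1)] by linarith
qed

end
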